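(* Let $n\ge 2$ be an integer. For every $D\in\mathcal{D}_n$, $${\rm per}(A_D)\le \omega(4n,n^2).$$ For $n$ even this inequality is sharp, i.e. there exists $D\in\mathcal{D}_n$ with ${\rm per}(A_D)=\omega(4n,n^2)$.
   Context: $K_{n,n}$ is the complete bipartite graph on $2n$ vertices. $\mathcal{D}_n$ is the set of all digraphs obtained from $K_{n,n}$ by assigning a direction to each edge. For $D\in\mathcal{D}_n$, $A_D$ is its $(0,1)$ adjacency matrix of order $2n$ (entry $1$ in position $(i,j)$ exactly when $(v_i,v_j)$ is a directed edge), and ${\rm per}$ denotes the permanent; ${\rm per}(A_D)$ is the number of directed $2$-factors of $D$ (disjoint unions of directed cycles covering all vertices). For positive integers $N\le M$, $$\omega(2N,M):=\left(\lfloor \tfrac{M}{N}\rfloor !\right)^{\frac{N-\alpha}{\lfloor M/N\rfloor}}\left(\lceil \tfrac{M}{N}\rceil !\right)^{\frac{\alpha}{\lceil M/N\rceil}},\qquad \alpha:=M-N\lfloor \tfrac{M}{N}\rfloor .$$ Thus $\omega(4n,n^2)$ is this quantity with $N=2n$ and $M=n^2$. *)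

theory Defs
  imports Complex_Main "Jordan_Normal_Form.Determinant" "Graph_Theory.Kuratowski"
begin

text \<open>
  Undirected graphs are symmetric digraphs, as in the theory of digraphs imported here. Vertices
  are numbered from 0, and the two colour classes are the first and the last \<open>n\<close> numbers.
\<close>

definition Knn :: "nat \<Rightarrow> nat pair_pre_digraph" where
  "Knn n = \<lparr> pverts = {0..<2*n},
             parcs = {0..<n} \<times> {n..<2*n} \<union> {n..<2*n} \<times> {0..<n} \<rparr>"

lemma complete_bipartite_Knn: "complete_bipartite_digraph n n (with_proj (Knn n))"
proof -
  have "{0..<2*n} = {0..<n} \<union> {n..<2*n}" "{0..<n} \<inter> {n..<2*n} = {}"
       "card {0..<n} = n" "card {n..<2*n} = n"
    by auto
  then show ?thesis
    unfolding complete_bipartite_digraph_pair_def Knn_def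
    by (intro conjI exI[of _ "{0..<n}"] exI[of _ "{n..<2*n}"]) simp_all
qed

definition orientations :: "'a pair_pre_digraph \<Rightarrow> 'a pair_pre_digraph set" where
  "orientations G =
    {D. pverts D = pverts G \<and> parcs D \<subseteq> parcs G \<and>
        (\<forall>(u, v) \<in> parcs G. (u, v) \<in> parcs D \<longleftrightarrow> (v, u) \<notin> parcs D)}"

definition bip_digraphs :: "nat \<Rightarrow> nat pair_pre_digraph set" where
  "bip_digraphs n = orientations (Knn n)"

text \<open>Meaningful for digraphs whose vertex set is an initial segment of the naturals.\<close>

definition adjacency_matrix :: "nat pair_pre_digraph \<Rightarrow> nat mat" where
  "adjacency_matrix D =
    mat (card (pverts D)) (card (pverts D)) (\<lambda>(i, j). if (i, j) \<in> parcs D then 1 else 0)"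

text \<open>As for the determinant, the value on non-square matrices is a dummy.\<close>

definition permanent :: "'a :: comm_semiring_1 mat \<Rightarrow> 'a" where
  "permanent A =
    (if dim_row A = dim_col A
     then \<Sum>p \<in> {p. p permutes {0..<dim_row A}}. \<Prod>i = 0..<dim_row A. A $$ (i, p i)
     else 0)"

text \<open>
  The first argument is \<open>2 N\<close>; the value is meaningful for even first argument and
  \<open>0 < N \<le> M\<close>. The subtractions do not truncate: \<open>\<alpha>\<close> is the remainder of \<open>M\<close> modulo \<open>N\<close>.
\<close>

definition omega :: "nat \<Rightarrow> nat \<Rightarrow> real" where
  "omega twoN M =
    (let N = twoN div 2;
         f = nat \<lfloor>real M / real N\<rfloor>;
         c = nat \<lceil>real M / real N\<rceil>;
         \<alpha> = M - N * f
     in (fact f) powr (real (N - \<alpha>) / real f) * (fact c) powr (real \<alpha> / real c))"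

end

(*
  Bregman's theorem bounds the permanent of a (0,1) matrix with row sums r_i by the product of the
  numbers (r_i!)^(1/r_i). An orientation of K_{n,n} has 2n rows with total row sum n^2, and since
  r -> ln (r!) / r is concave, the product is largest when the row sums are as equal as possible.
  Bregman's theorem is proved by Schrijver's argument: expand the permanent along every row and
  compare per * ln per for the matrix with the corresponding expressions for its minors.

  For n = 2k, split the vertices into blocks B0, B1 | B2, B3 of size k and let the edges go
  B0 -> B2 -> B1 -> B3 -> B0; the permanent is then at least (k!)^4.
*)
theory Submission
  imports Defs
begin

section \<open>The function $\ln(r!)/r$\<close>

text \<open>The logarithm of the row factor \<open>(r!)^(1/r)\<close> in Bregman's bound. Division
  by zero makes it 0 at \<open>r = 0\<close>, where concavity fails; hence the restriction to
  \<open>r >= 1\<close> below.\<close>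

definition log_fact_root :: "nat \<Rightarrow> real" where
  "log_fact_root r = ln (fact r) / real r"

lemma mult_log_fact_root: "real r * log_fact_root r = ln (fact r)"
  by (simp add: log_fact_root_def)

lemma ln_fact_Suc: "ln (fact (Suc r) :: real) = ln (real (Suc r)) + ln (fact r)"
  unfolding fact_Suc by (subst ln_mult) simp_all

text \<open>Concavity of \<open>log_fact_root\<close> at \<open>r - 1\<close>, \<open>r\<close>,
  \<open>r + 1\<close> with the denominators cleared. The induction step adds
  \<open>r * (r + 1)\<close> times the inequality
  \<open>ln r + ln (r + 2) <= 2 * ln (r + 1)\<close>, which is
  \<open>r * (r + 2) <= (r + 1)^2\<close>.\<close>

lemma two_ln_fact_le:
  assumes "r \<ge> 1"
  shows "2 * ln (fact r) \<le> real r * (real r + 1) * ln (real r) - real r * (real r - 1) * ln (real r + 1)"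
  using assms
proof (induction r rule: nat_induct_at_least)
  case base
  then show ?case by simp
next
  case (Suc r)
  have r: "real r > 0" using Suc by simp
  have "ln (real r) + ln (real r + 2) = ln (real r * (real r + 2))"
    using r by (simp add: ln_mult)
  also have "\<dots> \<le> ln ((real r + 1) ^ 2)"
    using r by (subst ln_le_cancel_iff) (auto simp: power2_eq_square algebra_simps intro!: add_pos_pos)
  also have "\<dots> = 2 * ln (real r + 1)"
    using r by (simp add: ln_realpow)
  finally have "real r * (real r + 1) * (ln (real r) + ln (real r + 2))
      \<le> real r * (real r + 1) * (2 * ln (real r + 1))"
    using r by (intro mult_left_mono) auto
  with Suc.IH show ?case
    unfolding ln_fact_Suc by (simp add: algebra_simps)
qed

lemma log_fact_root_increment_antimono:
  assumes "r \<ge> 1"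
  shows "log_fact_root (r + 2) - log_fact_root (r + 1) \<le> log_fact_root (r + 1) - log_fact_root r"
proof -
  define x where "x = real r"
  define a where "a = ln (fact r :: real)"
  define b where "b = ln (x + 1)"
  define c where "c = ln (x + 2)"
  have x: "x > 0" using assms by (simp add: x_def)
  have f1: "ln (fact (r + 1)) = a + b"
    using ln_fact_Suc[of r] by (simp add: a_def b_def x_def add_ac)
  have f2: "ln (fact (r + 2)) = a + b + c"
    using ln_fact_Suc[of "r + 1"] f1 by (simp add: c_def x_def add_ac)
  have "2 * (a + b) \<le> (x + 1) * (x + 2) * b - (x + 1) * x * c"
    using two_ln_fact_le[of "r + 1"] f1 by (simp add: b_def c_def x_def add_ac)
  \<comment> \<open>The desired inequality multiplied through by
    \<open>x * (x + 1) * (x + 2)\<close>.\<close>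
  hence "x * (x + 1) * (a + b + c) + (x + 1) * (x + 2) * a \<le> 2 * x * (x + 2) * (a + b)"
    by (simp add: algebra_simps)
  hence "(x * (x + 1) * (a + b + c) + (x + 1) * (x + 2) * a) / (x * (x + 1) * (x + 2))
      \<le> 2 * x * (x + 2) * (a + b) / (x * (x + 1) * (x + 2))"
    using x by (intro divide_right_mono) auto
  also have "2 * x * (x + 2) * (a + b) / (x * (x + 1) * (x + 2)) = 2 * ((a + b) / (x + 1))"
  proof -
    have "2 * x * (x + 2) * (a + b) / (x * (x + 1) * (x + 2))
        = ((x * (x + 2)) * (2 * (a + b))) / ((x * (x + 2)) * (x + 1))"
      by (simp only: mult_ac)
    also have "\<dots> = 2 * ((a + b) / (x + 1))"
      using x by (subst mult_divide_mult_cancel_left) auto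
    finally show ?thesis .
  qed
  also have "(x * (x + 1) * (a + b + c) + (x + 1) * (x + 2) * a) / (x * (x + 1) * (x + 2))
      = (a + b + c) / (x + 2) + a / x"
    using x by (simp add: add_divide_distrib)
  finally show ?thesis
    unfolding log_fact_root_def f1 f2 a_def[symmetric] by (simp add: x_def add_ac)
qed

text \<open>The increment at \<open>q\<close> serves as the slope of a tangent: by concavity later
  increments are no larger and earlier ones no smaller. Induction runs upwards and downwards from
  \<open>q\<close>.\<close>

lemma concave_sequence_le_tangent:
  fixes f :: "nat \<Rightarrow> real"
  assumes concave: "\<And>r. r \<ge> 1 \<Longrightarrow> f (r + 2) - f (r + 1) \<le> f (r + 1) - f r"
    and q: "q \<ge> 1" and r: "r \<ge> 1"
  shows "f r \<le> f q + (real r - real q) * (f (q + 1) - f q)"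
proof -
  have mono: "f (n + 1) - f n \<le> f (m + 1) - f m" if "m \<le> n" "m \<ge> 1" for m n
    using that
  proof (induction rule: dec_induct)
    case (step n)
    then show ?case using concave[of n] by simp
  qed simp
  show ?thesis
  proof (cases "q \<le> r")
    case True
    then show ?thesis
    proof (induction rule: dec_induct)
      case (step n)
      then show ?case using mono[of q n] q by (simp add: algebra_simps)
    qed simp
  next
    case False
    hence "r \<le> q" by simp
    then show ?thesis
      using r
    proof (induction rule: inc_induct)
      case (step n)
      then show ?case using mono[of n q] by (simp add: algebra_simps)
    qed simp
  qed
qed

lemma log_fact_root_le_tangent:
  assumes "q \<ge> 1" "r \<ge> 1"
  shows "log_fact_root r \<le>
    log_fact_root q + (real r - real q) * (log_fact_root (q + 1) - log_fact_root q)"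
  using concave_sequence_le_tangent[of log_fact_root, OF log_fact_root_increment_antimono assms] .

section \<open>The logarithm of omega\<close>

lemma nat_ceiling_divide_of_nat:
  assumes "N > 0" "M mod N \<noteq> 0"
  shows "nat \<lceil>real M / real N\<rceil> = M div N + 1"
proof -
  have "real M / real N = real (M div N) + real (M mod N) / real N"
    by (rule of_nat_of_nat_div_aux)
  moreover have "real (M mod N) / real N > 0" "real (M mod N) / real N \<le> 1"
    using assms by (simp_all add: less_imp_le)
  ultimately have "\<lceil>real M / real N\<rceil> = int (M div N + 1)"
    by (intro ceiling_unique) simp_all
  then show ?thesis by simp
qed

lemma omega_pos: "omega K M > 0"
  by (simp add: omega_def Let_def)

text \<open>The weights \<open>N - \<alpha>\<close> and \<open>\<alpha>\<close> on the values at
  \<open>q\<close> and \<open>q + 1\<close> are regrouped as value plus slope, the shape that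
  summing the tangent inequality over \<open>N\<close> rows produces.\<close>

lemma ln_omega:
  assumes N: "N > 0"
  shows "ln (omega (2 * N) M) = real N * log_fact_root (M div N)
    + real (M mod N) * (log_fact_root (M div N + 1) - log_fact_root (M div N))"
proof -
  define q where "q = M div N"
  define c where "c = nat \<lceil>real M / real N\<rceil>"
  have f: "nat \<lfloor>real M / real N\<rfloor> = q"
    by (simp add: q_def floor_divide_of_nat_eq)
  have \<alpha>: "M - N * q = M mod N"
    by (simp add: q_def minus_mult_div_eq_mod)
  have "2 * N div 2 = N" by simp
  hence "omega (2 * N) M = fact q powr (real (N - M mod N) / real q)
      * fact c powr (real (M mod N) / real c)"
    unfolding omega_def Let_def by (simp only: f \<alpha> c_def)
  hence "ln (omega (2 * N) M) = real (N - M mod N) / real q * ln (fact q)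
      + real (M mod N) / real c * ln (fact c)"
    by (simp add: ln_mult ln_powr)
  also have "\<dots> = real (N - M mod N) * log_fact_root q + real (M mod N) * log_fact_root c"
    by (simp add: log_fact_root_def)
  \<comment> \<open>If \<open>N\<close> divides \<open>M\<close>, the ceiling is \<open>q\<close>
    and not \<open>q + 1\<close>, but then both sides have weight 0.\<close>
  also have "real (M mod N) * log_fact_root c = real (M mod N) * log_fact_root (q + 1)"
    using nat_ceiling_divide_of_nat[OF N, of M] by (cases "M mod N = 0") (simp_all add: c_def q_def)
  also have "real (N - M mod N) = real N - real (M mod N)"
    using N by (simp add: of_nat_diff less_imp_le)
  finally show ?thesis
    by (simp add: q_def algebra_simps)
qed

text \<open>Summing the tangent inequality at \<open>q = M div N\<close>: the linear terms depend
  only on the total \<open>M\<close>, and \<open>M - N * q\<close> is the remainder occurring in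
  \<open>ln_omega\<close>.\<close>

lemma sum_log_fact_root_le_ln_omega:
  assumes I: "finite I" "card I = N" "N > 0" and M: "(\<Sum>i\<in>I. r i) = M" "N \<le> M"
    and r: "\<And>i. i \<in> I \<Longrightarrow> r i \<ge> 1"
  shows "(\<Sum>i\<in>I. log_fact_root (r i)) \<le> ln (omega (2 * N) M)"
proof -
  define q where "q = M div N"
  define d where "d = log_fact_root (q + 1) - log_fact_root q"
  have q: "q \<ge> 1"
    using I M by (simp add: q_def Suc_le_eq div_greater_zero_iff)
  have "(\<Sum>i\<in>I. log_fact_root (r i)) \<le> (\<Sum>i\<in>I. log_fact_root q + (real (r i) - real q) * d)"
    unfolding d_def using q r by (intro sum_mono log_fact_root_le_tangent)
  also have "\<dots> = real N * log_fact_root q + (real M - real N * real q) * d"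
    using I M(1) by (simp add: sum.distrib sum_subtractf flip: sum_distrib_right of_nat_sum)
  also have "real M - real N * real q = real (M mod N)"
    by (simp add: q_def minus_mult_div_eq_mod[symmetric] of_nat_diff)
  also have "real N * log_fact_root q + real (M mod N) * d = ln (omega (2 * N) M)"
    using ln_omega[OF \<open>N > 0\<close>] by (simp add: q_def d_def)
  finally show ?thesis .
qed

section \<open>Bregman's theorem\<close>

text \<open>The permanent of a (0,1) matrix with row supports \<open>A i\<close>, in the form of the
  set it counts. Arbitrary index sets allow rows and columns to be deleted without renumbering;
  extensionality outside \<open>I\<close> keeps the set finite.\<close>

definition transversals :: "'a set \<Rightarrow> ('a \<Rightarrow> 'b set) \<Rightarrow> ('a \<Rightarrow> 'b) set" where
  "transversals I A = {\<sigma> \<in> Pi\<^sub>E I A. inj_on \<sigma> I}"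

lemma finite_transversals:
  assumes "finite I" "\<And>i. i \<in> I \<Longrightarrow> finite (A i)"
  shows "finite (transversals I A)"
  unfolding transversals_def using finite_PiE[of I A] assms by simp

lemma restrict_transversal:
  assumes "\<sigma> \<in> transversals I A" "i \<in> I"
  shows "restrict \<sigma> (I - {i}) \<in> transversals (I - {i}) (\<lambda>j. A j - {\<sigma> i})"
proof -
  have "\<sigma> \<in> Pi\<^sub>E I A" and inj: "inj_on \<sigma> I"
    using assms(1) by (simp_all add: transversals_def)
  moreover have "\<sigma> j \<noteq> \<sigma> i" if "j \<in> I - {i}" for j
    using inj_onD[OF inj, of j i] that assms(2) by blast
  ultimately show ?thesis
    using inj_on_diff[OF inj, of "{i}"]
    by (simp add: transversals_def PiE_iff inj_on_restrict_eq)
qed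

text \<open>The expansion of a permanent along row \<open>i\<close>: fixing the entry in column
  \<open>k\<close> leaves a transversal of the minor.\<close>

lemma bij_betw_transversals_minor:
  assumes "i \<in> I" "k \<in> A i"
  shows "bij_betw (\<lambda>\<sigma>. restrict \<sigma> (I - {i})) {\<sigma> \<in> transversals I A. \<sigma> i = k}
    (transversals (I - {i}) (\<lambda>j. A j - {k}))"
proof (rule bij_betw_byWitness[where f' = "\<lambda>\<tau>. \<tau>(i := k)"])
  show "\<forall>\<sigma>\<in>{\<sigma> \<in> transversals I A. \<sigma> i = k}. (restrict \<sigma> (I - {i}))(i := k) = \<sigma>"
    by (auto simp: transversals_def PiE_iff extensional_def restrict_def fun_eq_iff)
  show "\<forall>\<tau>\<in>transversals (I - {i}) (\<lambda>j. A j - {k}). restrict (\<tau>(i := k)) (I - {i}) = \<tau>"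
    by (auto simp: transversals_def PiE_iff extensional_def restrict_def fun_eq_iff)
  show "(\<lambda>\<sigma>. restrict \<sigma> (I - {i})) ` {\<sigma> \<in> transversals I A. \<sigma> i = k}
      \<subseteq> transversals (I - {i}) (\<lambda>j. A j - {k})"
  proof (rule image_subsetI)
    fix \<sigma> assume "\<sigma> \<in> {\<sigma> \<in> transversals I A. \<sigma> i = k}"
    then show "restrict \<sigma> (I - {i}) \<in> transversals (I - {i}) (\<lambda>j. A j - {k})"
      using restrict_transversal[of \<sigma> I A i] assms(1) by simp
  qed
  show "(\<lambda>\<tau>. \<tau>(i := k)) ` transversals (I - {i}) (\<lambda>j. A j - {k})
      \<subseteq> {\<sigma> \<in> transversals I A. \<sigma> i = k}"
  proof (rule image_subsetI)
    fix \<tau> assume "\<tau> \<in> transversals (I - {i}) (\<lambda>j. A j - {k})"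
    hence \<tau>: "\<tau> \<in> Pi\<^sub>E (I - {i}) (\<lambda>j. A j - {k})" and inj: "inj_on \<tau> (I - {i})"
      by (simp_all add: transversals_def)
    have "\<tau>(i := k) \<in> Pi\<^sub>E (insert i (I - {i})) A"
      using \<tau> assms(2) by (simp add: PiE_iff extensional_def)
    moreover have "inj_on (\<tau>(i := k)) (insert i (I - {i}))"
    proof -
      have "inj_on (\<tau>(i := k)) (I - {i})"
        using inj by (simp add: inj_on_def)
      moreover have "k \<notin> (\<tau>(i := k)) ` (I - {i})"
        using \<tau> by (fastforce dest: PiE_mem)
      ultimately show ?thesis by (simp only: inj_on_insert Diff_idemp fun_upd_same simp_thms)
    qed
    ultimately show "\<tau>(i := k) \<in> {\<sigma> \<in> transversals I A. \<sigma> i = k}"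
      using assms(1) by (simp add: transversals_def insert_absorb)
  qed
qed

text \<open>Jensen's inequality for \<open>x * ln x\<close>, obtained termwise from
  \<open>ln x <= x - 1\<close> at \<open>x = m / (r * p k)\<close>; the resulting bounds
  \<open>m / r - p k\<close> add up to 0.\<close>

lemma log_sum_inequality:
  fixes p :: "'a \<Rightarrow> real"
  assumes K: "finite K" "K \<noteq> {}" and p: "\<And>k. k \<in> K \<Longrightarrow> p k \<ge> 0" and pos: "sum p K > 0"
  shows "sum p K * ln (sum p K) \<le> sum p K * ln (real (card K)) + (\<Sum>k\<in>K. p k * ln (p k))"
proof -
  define m where "m = sum p K"
  define r where "r = real (card K)"
  have m: "m > 0" and r: "r > 0" using pos K by (auto simp: m_def r_def card_gt_0_iff)
  have "p k * ln m - p k * ln r - p k * ln (p k) \<le> m / r - p k" if k: "k \<in> K" for k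
  \<comment> \<open>A zero weight makes the left side 0, so minors with permanent 0 are
    covered.\<close>
  proof (cases "p k = 0")
    case False
    hence pk: "p k > 0" using p[OF k] by simp
    have "ln m - ln r - ln (p k) = ln (m / (r * p k))"
      using m r pk by (simp add: ln_div ln_mult)
    also have "\<dots> \<le> m / (r * p k) - 1"
      using m r pk by (intro ln_le_minus_one) simp
    finally have "p k * (ln m - ln r - ln (p k)) \<le> p k * (m / (r * p k) - 1)"
      using pk by (intro mult_left_mono) auto
    also have "\<dots> = m / r - p k"
      using pk r by (simp add: field_simps)
    finally show ?thesis by (simp add: algebra_simps)
  qed (use m r in simp)
  hence "(\<Sum>k\<in>K. p k * ln m - p k * ln r - p k * ln (p k)) \<le> (\<Sum>k\<in>K. m / r - p k)"
    by (rule sum_mono)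
  also have "\<dots> = 0"
    using r by (simp add: sum_subtractf m_def[symmetric]) (simp add: r_def)
  also have "(\<Sum>k\<in>K. p k * ln m - p k * ln r - p k * ln (p k))
      = m * ln m - m * ln r - (\<Sum>k\<in>K. p k * ln (p k))"
    by (simp add: sum_subtractf m_def flip: sum_distrib_right)
  finally show ?thesis by (simp add: m_def r_def)
qed

text \<open>Deleting a column of \<open>B - {k}\<close> shortens the row \<open>B\<close> to length
  \<open>r\<close>, and these \<open>r\<close> terms give \<open>ln (r!)\<close>. The other columns
  leave the row unchanged and contribute \<open>- ln ((r + 1)!)\<close> besides the main term; the
  factorials combine to \<open>- ln (r + 1)\<close>.\<close>

lemma sum_log_fact_root_Diff_singleton:
  assumes J: "finite J" "B \<subseteq> J" and k: "k \<in> B"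
  shows "(\<Sum>l\<in>J - {k}. log_fact_root (card (B - {l})))
    = real (card J) * log_fact_root (card B) - ln (real (card B))"
proof -
  have B: "finite B" using J finite_subset by blast
  then obtain r where r: "card B = Suc r"
    using k by (metis card_gt_0_iff empty_iff gr0_conv_Suc)
  have "J - {k} = (B - {k}) \<union> (J - B)" using k J by auto
  hence "(\<Sum>l\<in>J - {k}. log_fact_root (card (B - {l})))
      = (\<Sum>l\<in>B - {k}. log_fact_root (card (B - {l}))) + (\<Sum>l\<in>J - B. log_fact_root (card (B - {l})))"
    using J B by (simp add: sum.union_disjoint Int_Diff disjoint_iff)
  also have "(\<Sum>l\<in>B - {k}. log_fact_root (card (B - {l}))) = (\<Sum>l\<in>B - {k}. log_fact_root r)"
    using r B by (intro sum.cong) auto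
  also have "\<dots> = ln (fact r)"
    using r B k by (simp add: mult_log_fact_root)
  also have "(\<Sum>l\<in>J - B. log_fact_root (card (B - {l}))) = (\<Sum>l\<in>J - B. log_fact_root (card B))"
    by (intro sum.cong) auto
  also have "\<dots> = (real (card J) - real (card B)) * log_fact_root (card B)"
    using J B by (simp add: card_Diff_subset card_mono of_nat_diff)
  also have "\<dots> = real (card J) * log_fact_root (card B) - ln (fact (card B))"
    by (simp add: left_diff_distrib mult_log_fact_root)
  finally show ?thesis
    using ln_fact_Suc[of r] r by simp
qed

text \<open>Induction on the number of rows. Averaging over all rows and all transversals makes the
  induction hypothesis for the minors add up to exactly the bound wanted.\<close>

theorem bregman:
  assumes "finite I" "finite J" "card I = card J" "\<And>i. i \<in> I \<Longrightarrow> A i \<subseteq> J" "transversals I A \<noteq> {}"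
  shows "ln (real (card (transversals I A))) \<le> (\<Sum>i\<in>I. log_fact_root (card (A i)))"
  using assms
proof (induction "card I" arbitrary: I J A)
  case 0
  then have "transversals I A = {\<lambda>_. undefined}"
    by (auto simp: transversals_def)
  with 0 show ?case by simp
next
  case (Suc n)
  define T where "T = transversals I A"
  define m where "m = real (card T)"
  define p where "p i k = card (transversals (I - {i}) (\<lambda>j. A j - {k}))" for i k
  let ?L = log_fact_root
  have finA: "finite (A i)" if "i \<in> I" for i
    using Suc.prems that finite_subset by blast
  have finT: "finite T"
    unfolding T_def using Suc.prems(1) finA by (rule finite_transversals)
  have m: "m > 0"
    using finT Suc.prems(5) by (simp add: m_def T_def card_gt_0_iff)
  have mem: "\<sigma> i \<in> A i" if "\<sigma> \<in> T" "i \<in> I" for \<sigma> i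
    using that by (auto simp: T_def transversals_def)
  have img: "\<sigma> ` I = J" and inj: "inj_on \<sigma> I" if "\<sigma> \<in> T" for \<sigma>
  proof -
    show inj: "inj_on \<sigma> I" using that by (simp add: T_def transversals_def)
    have "\<sigma> ` I \<subseteq> J" using mem[OF that] Suc.prems(4) by blast
    with Suc.prems inj show "\<sigma> ` I = J"
      by (intro card_subset_eq) (simp_all add: card_image)
  qed
  have fiber: "card {\<sigma> \<in> T. \<sigma> i = k} = p i k" if "i \<in> I" "k \<in> A i" for i k
    unfolding T_def p_def using bij_betw_same_card[OF bij_betw_transversals_minor[of i I k A, OF that]] .
  have row: "m * ln m \<le> m * ln (real (card (A i))) + (\<Sum>\<sigma>\<in>T. ln (real (p i (\<sigma> i))))" if i: "i \<in> I" for i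
  proof -
    have sub: "(\<lambda>\<sigma>. \<sigma> i) ` T \<subseteq> A i" using mem i by auto
    have "(\<Sum>k\<in>A i. real (p i k)) = (\<Sum>k\<in>A i. \<Sum>\<sigma>\<in>{\<sigma> \<in> T. \<sigma> i = k}. 1)"
      using i by (intro sum.cong) (simp_all add: fiber)
    also have "\<dots> = m"
      using sum.group[OF finT finA[OF i] sub, of "\<lambda>_. 1 :: real"] by (simp add: m_def)
    finally have sum_p: "(\<Sum>k\<in>A i. real (p i k)) = m" .
    \<comment> \<open>Column \<open>k\<close> equals \<open>\<sigma> i\<close> for exactly
      \<open>p i k\<close> transversals, so the weight \<open>p i k\<close> turns into a sum over
      \<open>T\<close>.\<close>
    have "(\<Sum>k\<in>A i. real (p i k) * ln (real (p i k)))
        = (\<Sum>k\<in>A i. \<Sum>\<sigma>\<in>{\<sigma> \<in> T. \<sigma> i = k}. ln (real (p i (\<sigma> i))))"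
      using i by (intro sum.cong) (simp_all add: fiber)
    also have "\<dots> = (\<Sum>\<sigma>\<in>T. ln (real (p i (\<sigma> i))))"
      using sum.group[OF finT finA[OF i] sub] .
    finally have sum_plnp: "(\<Sum>k\<in>A i. real (p i k) * ln (real (p i k)))
      = (\<Sum>\<sigma>\<in>T. ln (real (p i (\<sigma> i))))" .
    have "A i \<noteq> {}" using sum_p m by auto
    then show ?thesis
      using log_sum_inequality[of "A i" "\<lambda>k. real (p i k)"] finA[OF i] m
      unfolding sum_p sum_plnp by simp
  qed
  have minors: "(\<Sum>i\<in>I. ln (real (p i (\<sigma> i))))
      \<le> (\<Sum>j\<in>I. real (card I) * ?L (card (A j)) - ln (real (card (A j))))" if \<sigma>: "\<sigma> \<in> T" for \<sigma>
  proof -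
    have "ln (real (p i (\<sigma> i))) \<le> (\<Sum>j\<in>I - {i}. ?L (card (A j - {\<sigma> i})))" if i: "i \<in> I" for i
      unfolding p_def
    proof (rule Suc.hyps(1)[where J = "J - {\<sigma> i}"])
      have "\<sigma> i \<in> J" using img[OF \<sigma>] i by auto
      then show "card (I - {i}) = card (J - {\<sigma> i})"
        using Suc.prems i by simp
      show "n = card (I - {i})" using Suc.hyps(2) Suc.prems i by simp
      \<comment> \<open>The restriction of \<open>\<sigma>\<close> is a transversal of this minor,
        so the induction hypothesis applies to it.\<close>
      show "transversals (I - {i}) (\<lambda>j. A j - {\<sigma> i}) \<noteq> {}"
        using restrict_transversal[of \<sigma> I A i] \<sigma> i unfolding T_def by blast
    qed (use Suc.prems in auto)
    hence "(\<Sum>i\<in>I. ln (real (p i (\<sigma> i)))) \<le> (\<Sum>i\<in>I. \<Sum>j\<in>I - {i}. ?L (card (A j - {\<sigma> i})))"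
      by (rule sum_mono)
    \<comment> \<open>Regrouping by the surviving row \<open>j\<close> in place of the deleted row
      \<open>i\<close>.\<close>
    also have "\<dots> = (\<Sum>j\<in>I. \<Sum>i\<in>I - {j}. ?L (card (A j - {\<sigma> i})))"
    proof -
      have "(\<Sum>i\<in>I. \<Sum>j | j \<in> I \<and> j \<noteq> i. ?L (card (A j - {\<sigma> i})))
        = (\<Sum>j\<in>I. \<Sum>i | i \<in> I \<and> j \<noteq> i. ?L (card (A j - {\<sigma> i})))"
        using Suc.prems(1) by (intro sum.swap_restrict)
      moreover have "{j \<in> I. j \<noteq> i} = I - {i}" "{j \<in> I. i \<noteq> j} = I - {i}" for i
        by auto
      ultimately show ?thesis by simp
    qed
    also have "\<dots> = (\<Sum>j\<in>I. real (card I) * ?L (card (A j)) - ln (real (card (A j))))"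
    proof (rule sum.cong)
      fix j assume j: "j \<in> I"
      \<comment> \<open>As the deleted row runs through \<open>I - {j}\<close>, the deleted column
        runs once through all columns other than \<open>\<sigma> j\<close>.\<close>
      have "\<sigma> ` (I - {j}) = J - {\<sigma> j}"
        using img[OF \<sigma>] inj[OF \<sigma>] j by (auto simp: inj_on_def)
      hence "(\<Sum>i\<in>I - {j}. ?L (card (A j - {\<sigma> i}))) = (\<Sum>l\<in>J - {\<sigma> j}. ?L (card (A j - {l})))"
        using sum.reindex[of \<sigma> "I - {j}" "\<lambda>l. ?L (card (A j - {l}))"] inj_on_diff[OF inj[OF \<sigma>]]
        by (simp add: o_def)
      then show "(\<Sum>i\<in>I - {j}. ?L (card (A j - {\<sigma> i})))
          = real (card I) * ?L (card (A j)) - ln (real (card (A j)))"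
        using sum_log_fact_root_Diff_singleton[of J "A j" "\<sigma> j"] Suc.prems j mem[OF \<sigma> j] by simp
    qed simp
    finally show ?thesis .
  qed
  have "real (card I) * (m * ln m) = (\<Sum>i\<in>I. m * ln m)" by simp
  also have "\<dots> \<le> (\<Sum>i\<in>I. m * ln (real (card (A i))) + (\<Sum>\<sigma>\<in>T. ln (real (p i (\<sigma> i)))))"
    using row by (rule sum_mono)
  also have "\<dots> = m * (\<Sum>i\<in>I. ln (real (card (A i)))) + (\<Sum>\<sigma>\<in>T. \<Sum>i\<in>I. ln (real (p i (\<sigma> i))))"
    by (simp add: sum.distrib sum_distrib_left sum.swap[of _ T])
  also have "\<dots> \<le> m * (\<Sum>i\<in>I. ln (real (card (A i))))
      + (\<Sum>\<sigma>\<in>T. \<Sum>j\<in>I. real (card I) * ?L (card (A j)) - ln (real (card (A j))))"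
    by (rule add_left_mono, rule sum_mono, rule minors)
  \<comment> \<open>The terms \<open>ln (card (A i))\<close> from \<open>row\<close> cancel against
    those from \<open>minors\<close>.\<close>
  also have "\<dots> = m * (real (card I) * (\<Sum>j\<in>I. ?L (card (A j))))"
    by (simp add: m_def sum_subtractf right_diff_distrib sum_distrib_left)
  finally have "(m * real (card I)) * ln m \<le> (m * real (card I)) * (\<Sum>j\<in>I. ?L (card (A j)))"
    by (simp add: mult_ac)
  moreover have "m * real (card I) > 0" using m Suc.hyps(2) by (simp flip: Suc.hyps(2))
  ultimately have "ln m \<le> (\<Sum>j\<in>I. ?L (card (A j)))"
    by (simp only: mult_le_cancel_left_pos)
  then show ?case by (simp add: m_def T_def)
qed

section \<open>Bregman's bound for a given total row sum\<close>

lemma card_transversals_le_omega: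
  assumes I: "finite I" "card I = N" "N > 0" and J: "finite J" "card J = N"
    and A: "\<And>i. i \<in> I \<Longrightarrow> A i \<subseteq> J" and M: "(\<Sum>i\<in>I. card (A i)) = M" "N \<le> M"
  shows "real (card (transversals I A)) \<le> omega (2 * N) M"
proof (cases "transversals I A = {}")
  case True
  then show ?thesis using omega_pos[of "2 * N" M] by simp
next
  case False
  have finA: "finite (A i)" if "i \<in> I" for i
    using A[OF that] J finite_subset by blast
  obtain \<sigma> where "\<sigma> \<in> Pi\<^sub>E I A"
    using False by (auto simp: transversals_def)
  \<comment> \<open>A transversal excludes empty rows, so the concavity estimate is available for
    every row sum.\<close>
  hence pos: "card (A i) \<ge> 1" if "i \<in> I" for i
    using finA[OF that] PiE_mem[of \<sigma> I A i] that by (auto simp: Suc_le_eq card_gt_0_iff)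
  have "ln (real (card (transversals I A))) \<le> (\<Sum>i\<in>I. log_fact_root (card (A i)))"
    using I J A False by (intro bregman[where J = J]) simp_all
  also have "\<dots> \<le> ln (omega (2 * N) M)"
    using I M pos by (rule sum_log_fact_root_le_ln_omega)
  finally have "ln (real (card (transversals I A))) \<le> ln (omega (2 * N) M)" .
  moreover have "card (transversals I A) > 0"
    using False finite_transversals[OF I(1) finA] by (simp add: card_gt_0_iff)
  ultimately show ?thesis
    using omega_pos[of "2 * N" M] by simp
qed

section \<open>Lower bounds from disjoint full blocks\<close>

text \<open>Any of the \<open>k!\<close> bijections of the full block glues to any transversal of
  the other rows: these rows avoid the columns \<open>J\<close>, so the union stays injective, and
  the two pieces can be recovered from it.\<close>

lemma fact_mult_card_transversals_le:
  assumes fin: "finite I'" "\<And>i. i \<in> I' \<Longrightarrow> finite (A i)"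
    and block: "finite I" "finite J" "card I = card J" "\<And>i. i \<in> I \<Longrightarrow> A i = J"
    and disj: "I \<inter> I' = {}" "\<And>i. i \<in> I' \<Longrightarrow> A i \<inter> J = {}"
  shows "fact (card I) * card (transversals I' A) \<le> card (transversals (I \<union> I') A)"
proof -
  define glue where "glue = (\<lambda>(\<sigma>, \<tau>) x. if x \<in> I then \<sigma> x else \<tau> x :: 'b)"
  have "{0..<card J} = {..<card J}" by auto
  hence "card (transversals I (\<lambda>_. J)) = fact (card I)"
    unfolding transversals_def using block
    by (subst card_inj_on_subset_funcset) (simp_all add: fact_prod_rev)
  hence "fact (card I) * card (transversals I' A)
      = card (transversals I (\<lambda>_. J) \<times> transversals I' A)"
    by (simp add: card_cartesian_product)
  also have "\<dots> \<le> card (transversals (I \<union> I') A)"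
  proof (rule card_inj_on_le)
    show "inj_on glue (transversals I (\<lambda>_. J) \<times> transversals I' A)"
    proof (intro inj_onI, clarsimp)
      fix \<sigma> \<tau> \<sigma>' \<tau>'
      assume "\<sigma> \<in> transversals I (\<lambda>_. J)" "\<tau> \<in> transversals I' A"
        "\<sigma>' \<in> transversals I (\<lambda>_. J)" "\<tau>' \<in> transversals I' A" and eq: "glue (\<sigma>, \<tau>) = glue (\<sigma>', \<tau>')"
      hence ext: "\<sigma> \<in> extensional I" "\<sigma>' \<in> extensional I" "\<tau> \<in> extensional I'" "\<tau>' \<in> extensional I'"
        by (auto simp: transversals_def PiE_def)
      have "\<sigma> x = \<sigma>' x" if "x \<in> I" for x
        using fun_cong[OF eq, of x] that by (simp add: glue_def)
      moreover have "\<tau> x = \<tau>' x" if "x \<in> I'" for x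
        using fun_cong[OF eq, of x] that disj by (auto simp: glue_def split: if_splits)
      ultimately show "\<sigma> = \<sigma>' \<and> \<tau> = \<tau>'"
        using ext extensionalityI by metis
    qed
    show "glue ` (transversals I (\<lambda>_. J) \<times> transversals I' A) \<subseteq> transversals (I \<union> I') A"
    proof (clarsimp simp: image_subset_iff)
      fix \<sigma> \<tau>
      assume \<sigma>: "\<sigma> \<in> transversals I (\<lambda>_. J)" and \<tau>: "\<tau> \<in> transversals I' A"
      have 1: "glue (\<sigma>, \<tau>) x = \<sigma> x" "\<sigma> x \<in> J" if "x \<in> I" for x
        using that \<sigma> by (auto simp: glue_def transversals_def)
      have 2: "glue (\<sigma>, \<tau>) x = \<tau> x" "\<tau> x \<in> A x" "\<tau> x \<notin> J" if "x \<in> I'" for x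
        using that \<tau> disj by (auto simp: glue_def transversals_def)
      have "glue (\<sigma>, \<tau>) \<in> Pi\<^sub>E (I \<union> I') A"
        using 1 2 \<tau> block(4) by (auto simp: glue_def transversals_def PiE_def extensional_def)
      moreover have "inj_on (glue (\<sigma>, \<tau>)) (I \<union> I')"
      proof (rule inj_onI)
        fix x y assume "x \<in> I \<union> I'" "y \<in> I \<union> I'" "glue (\<sigma>, \<tau>) x = glue (\<sigma>, \<tau>) y"
        moreover have "inj_on \<sigma> I" "inj_on \<tau> I'"
          using \<sigma> \<tau> by (auto simp: transversals_def)
        ultimately show "x = y"
          using 1 2 by (metis Un_iff inj_onD)
      qed
      ultimately show "glue (\<sigma>, \<tau>) \<in> transversals (I \<union> I') A"
        by (simp add: transversals_def)
    qed
    show "finite (transversals (I \<union> I') A)"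
      using fin block by (intro finite_transversals) auto
  qed
  finally show ?thesis .
qed

text \<open>One full block is split off at a time; its columns are disjoint from those of the
  remaining blocks.\<close>

lemma fact_power_le_card_transversals:
  assumes "finite B" "\<And>b. b \<in> B \<Longrightarrow> finite (I b)" "\<And>b. b \<in> B \<Longrightarrow> finite (J b)"
    "\<And>b. b \<in> B \<Longrightarrow> card (I b) = k" "\<And>b. b \<in> B \<Longrightarrow> card (J b) = k"
    "\<And>b i. b \<in> B \<Longrightarrow> i \<in> I b \<Longrightarrow> A i = J b"
    "disjoint_family_on I B" "disjoint_family_on J B"
  shows "fact k ^ card B \<le> card (transversals (\<Union>b\<in>B. I b) A)"
  using assms
proof (induction B rule: finite_induct)
  case empty
  have "transversals {} A = {\<lambda>_. undefined}"
    by (simp add: transversals_def)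
  then show ?case by simp
next
  case (insert b B)
  have disj: "I b \<inter> I c = {}" "J b \<inter> J c = {}" if "c \<in> B" for c
    using insert.hyps(2) insert.prems(6,7) that by (auto simp: disjoint_family_on_def)
  have A: "A i = J c" if "c \<in> B" "i \<in> I c" for c i
    by (rule insert.prems(5)) (use that in simp_all)
  have "fact (card (I b)) * card (transversals (\<Union>c\<in>B. I c) A)
      \<le> card (transversals (I b \<union> (\<Union>c\<in>B. I c)) A)"
  proof (rule fact_mult_card_transversals_le)
    show "finite (\<Union>c\<in>B. I c)" "finite (I b)" "finite (J b)" "card (I b) = card (J b)"
      using insert.hyps(1) insert.prems(1-4) by simp_all
    show "I b \<inter> (\<Union>c\<in>B. I c) = {}"
      using disj(1) by blast
    show "A i = J b" if "i \<in> I b" for i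
      by (rule insert.prems(5)) (use that in simp_all)
    fix i assume "i \<in> (\<Union>c\<in>B. I c)"
    then obtain c where c: "c \<in> B" "i \<in> I c"
      by blast
    show "finite (A i)" "A i \<inter> J b = {}"
      using insert.prems(2)[of c] disj(2)[OF c(1)] c(1) by (simp_all add: A[OF c] Int_commute)
  qed
  hence step: "fact k * card (transversals (\<Union>c\<in>B. I c) A)
      \<le> card (transversals (\<Union>c\<in>insert b B. I c) A)"
    using insert.prems(3) by simp
  have "fact k ^ card B \<le> card (transversals (\<Union>c\<in>B. I c) A)"
    using insert.prems(1-5) insert.prems(6,7)[THEN disjoint_family_on_mono[OF subset_insertI[of B b]]]
    by (intro insert.IH) simp_all
  hence "fact k * fact k ^ card B \<le> fact k * card (transversals (\<Union>c\<in>B. I c) A)"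
    by (rule mult_le_mono2)
  also note step
  finally show ?case
    using insert.hyps by simp
qed

section \<open>Orientations of the complete bipartite graph\<close>

text \<open>The product for \<open>p\<close> is 1 exactly if \<open>p\<close> chooses an element of
  each support. Permutations and transversals differ only outside the index range, where the former
  are the identity and the latter \<open>undefined\<close>.\<close>

lemma permanent_01_eq_card_transversals:
  assumes A: "\<And>i. i < N \<Longrightarrow> A i \<subseteq> {0..<N}"
  shows "permanent (mat N N (\<lambda>(i, j). if j \<in> A i then 1 else 0) :: nat mat)
    = card (transversals {0..<N} A)"
proof -
  let ?P = "{p. p permutes {0..<N}}"
  have "permanent (mat N N (\<lambda>(i, j). if j \<in> A i then 1 else 0) :: nat mat)
      = (\<Sum>p\<in>?P. \<Prod>i = 0..<N. if p i \<in> A i then 1 else 0)"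
  proof -
    have "p i < N" if "p permutes {0..<N}" "i < N" for p i
      using permutes_in_image[OF that(1), of i] that(2) by simp
    then show ?thesis
      unfolding permanent_def by (auto intro!: sum.cong[OF refl] prod.cong[OF refl])
  qed
  also have "\<dots> = (\<Sum>p\<in>?P. if \<forall>i<N. p i \<in> A i then 1 else 0)"
    by (intro sum.cong) auto
  also have "\<dots> = card {p \<in> ?P. \<forall>i<N. p i \<in> A i}"
    by (simp add: sum.If_cases finite_permutations Int_def)
  also have "\<dots> = card (transversals {0..<N} A)"
  proof (rule bij_betw_same_card[of "\<lambda>p. restrict p {0..<N}"])
    let ?extend = "\<lambda>\<sigma> x. if x < N then \<sigma> x else x"
    show "bij_betw (\<lambda>p. restrict p {0..<N}) {p \<in> ?P. \<forall>i<N. p i \<in> A i} (transversals {0..<N} A)"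
    proof (rule bij_betw_byWitness[where f' = ?extend])
      show "\<forall>p\<in>{p \<in> ?P. \<forall>i<N. p i \<in> A i}. ?extend (restrict p {0..<N}) = p"
        by (auto simp: permutes_def fun_eq_iff)
      show "\<forall>\<sigma>\<in>transversals {0..<N} A. restrict (?extend \<sigma>) {0..<N} = \<sigma>"
        by (auto simp: transversals_def PiE_def extensional_def fun_eq_iff)
      show "(\<lambda>p. restrict p {0..<N}) ` {p \<in> ?P. \<forall>i<N. p i \<in> A i} \<subseteq> transversals {0..<N} A"
        by (auto simp: transversals_def permutes_inj_on)
      show "?extend ` transversals {0..<N} A \<subseteq> {p \<in> ?P. \<forall>i<N. p i \<in> A i}"
      proof (clarsimp simp: image_subset_iff)
        fix \<sigma> assume "\<sigma> \<in> transversals {0..<N} A"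
        hence \<sigma>: "\<sigma> \<in> Pi\<^sub>E {0..<N} A" and inj: "inj_on \<sigma> {0..<N}"
          by (simp_all add: transversals_def)
        have mem: "\<sigma> i \<in> A i" if "i < N" for i
          using PiE_mem[OF \<sigma>] that by simp
        have "\<sigma> ` {0..<N} \<subseteq> {0..<N}" using mem A by fastforce
        with inj have "bij_betw \<sigma> {0..<N} {0..<N}"
          unfolding bij_betw_def using endo_inj_surj[OF finite_atLeastLessThan] by blast
        hence "bij_betw (?extend \<sigma>) {0..<N} {0..<N}"
          by (subst bij_betw_cong[of _ _ \<sigma>]) auto
        hence "?extend \<sigma> permutes {0..<N}"
          by (rule bij_imp_permutes) auto
        with mem show "?extend \<sigma> permutes {0..<N} \<and> (\<forall>i<N. \<sigma> i \<in> A i)" by blast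
      qed
    qed
  qed
  finally show ?thesis .
qed

section \<open>Arc count and upper bound for orientations\<close>

lemma pverts_bip_digraph: "D \<in> bip_digraphs n \<Longrightarrow> pverts D = {0..<2 * n}"
  by (simp add: bip_digraphs_def orientations_def Knn_def)

lemma parcs_bip_digraph_subset:
  "D \<in> bip_digraphs n \<Longrightarrow> parcs D \<subseteq> {0..<n} \<times> {n..<2 * n} \<union> {n..<2 * n} \<times> {0..<n}"
  by (simp add: bip_digraphs_def orientations_def Knn_def)

lemma bip_digraph_oriented:
  assumes "D \<in> bip_digraphs n" "u < n" "n \<le> v" "v < 2 * n"
  shows "(u, v) \<in> parcs D \<longleftrightarrow> (v, u) \<notin> parcs D"
proof -
  have "(u, v) \<in> parcs (Knn n)" using assms by (simp add: Knn_def)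
  with assms(1) show ?thesis unfolding bip_digraphs_def orientations_def by blast
qed

lemma permanent_adjacency_matrix:
  assumes "D \<in> bip_digraphs n"
  shows "permanent (adjacency_matrix D) = card (transversals {0..<2 * n} (\<lambda>i. {j. (i, j) \<in> parcs D}))"
proof -
  have "{j. (i, j) \<in> parcs D} \<subseteq> {0..<2 * n}" if "i < 2 * n" for i
    using parcs_bip_digraph_subset[OF assms] by fastforce
  then show ?thesis
    using permanent_01_eq_card_transversals[of "2 * n" "\<lambda>i. {j. (i, j) \<in> parcs D}"]
    by (simp add: adjacency_matrix_def pverts_bip_digraph[OF assms])
qed

text \<open>Reversal matches the arcs from right to left with the pairs in
  \<open>L \<times> R\<close> that are not arcs, so the arcs are as many as the pairs in
  \<open>L \<times> R\<close>.\<close>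

lemma card_parcs_bip_digraph:
  assumes "D \<in> bip_digraphs n"
  shows "card (parcs D) = n ^ 2"
proof -
  define L where "L = {0..<n}"
  define R where "R = {n..<2 * n}"
  have LR: "L \<inter> R = {}" "finite L" "finite R" "card L = n" "card R = n"
    by (simp_all add: L_def R_def ivl_disj_int_two)
  have sub: "parcs D \<subseteq> L \<times> R \<union> R \<times> L"
    using parcs_bip_digraph_subset[OF assms] by (simp only: L_def R_def)
  have ori: "(u, v) \<in> parcs D \<longleftrightarrow> (v, u) \<notin> parcs D" if "u \<in> L" "v \<in> R" for u v
    using bip_digraph_oriented[OF assms, of u v] that by (simp add: L_def R_def)
  have fin: "finite (L \<times> R)" "finite (parcs D)"
    using finite_subset[OF sub] LR by (simp_all only: finite_Un finite_cartesian_product simp_thms)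
  have "prod.swap ` (parcs D - L \<times> R) = L \<times> R - parcs D"
  proof
    show "prod.swap ` (parcs D - L \<times> R) \<subseteq> L \<times> R - parcs D"
    proof (rule image_subsetI)
      fix e assume e: "e \<in> parcs D - L \<times> R"
      obtain u v where uv: "e = (u, v)" by (cases e)
      have "(v, u) \<in> L \<times> R" using e uv sub by blast
      then show "prod.swap e \<in> L \<times> R - parcs D" using e uv ori[of v u] by simp
    qed
    show "L \<times> R - parcs D \<subseteq> prod.swap ` (parcs D - L \<times> R)"
    proof
      fix e assume e: "e \<in> L \<times> R - parcs D"
      obtain u v where uv: "e = (u, v)" by (cases e)
      have "(v, u) \<in> parcs D - L \<times> R" using e uv ori[of u v] LR(1) by blast
      then show "e \<in> prod.swap ` (parcs D - L \<times> R)" by (rule rev_image_eqI) (simp only: uv swap_simp)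
    qed
  qed
  hence "card (parcs D - L \<times> R) = card (L \<times> R - parcs D)"
    using card_image[OF inj_on_subset[OF inj_swap subset_UNIV], of "parcs D - L \<times> R"] by simp
  moreover have "card (parcs D) = card (parcs D \<inter> L \<times> R) + card (parcs D - L \<times> R)"
    using card_Int_Diff[OF fin(2)] .
  moreover have "card (L \<times> R) = card (parcs D \<inter> L \<times> R) + card (L \<times> R - parcs D)"
    using card_Int_Diff[OF fin(1), of "parcs D"] by (simp only: Int_commute)
  ultimately show ?thesis
    using LR by (simp only: card_cartesian_product power2_eq_square)
qed

lemma permanent_le_omega:
  assumes n: "n \<ge> 2" and D: "D \<in> bip_digraphs n"
  shows "real (permanent (adjacency_matrix D)) \<le> omega (4 * n) (n ^ 2)"
proof -
  define A where "A i = {j. (i, j) \<in> parcs D}" for i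
  have parcs: "parcs D \<subseteq> {0..<2 * n} \<times> {0..<2 * n}"
    using parcs_bip_digraph_subset[OF D] by fastforce
  hence A: "A i \<subseteq> {0..<2 * n}" for i
    by (auto simp: A_def)
  have "parcs D = Sigma {0..<2 * n} A"
    using parcs by (auto simp: A_def)
  moreover have "finite (A i)" for i
    using A finite_subset by blast
  ultimately have "(\<Sum>i\<in>{0..<2 * n}. card (A i)) = n ^ 2"
    using card_parcs_bip_digraph[OF D] by (simp add: card_SigmaI)
  \<comment> \<open>Here \<open>N = 2 * n\<close> and \<open>M = n ^ 2\<close>; the condition
    \<open>N <= M\<close> is where \<open>n >= 2\<close> enters.\<close>
  hence "real (card (transversals {0..<2 * n} A)) \<le> omega (2 * (2 * n)) (n ^ 2)"
    using n A by (intro card_transversals_le_omega[where J = "{0..<2 * n}"])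
      (simp_all add: power2_eq_square)
  then show ?thesis
    using permanent_adjacency_matrix[OF D] by (simp add: A_def[abs_def])
qed

section \<open>The extremal orientation for even n\<close>

text \<open>The quotient \<open>M / N = 4 * k * k / (4 * k)\<close> is the integer \<open>k\<close>,
  so the second factor of \<open>omega\<close> is 1 and the first has exponent 4.\<close>

lemma omega_even:
  assumes "k > 0"
  shows "omega (4 * (2 * k)) ((2 * k) ^ 2) = fact k ^ 4"
proof -
  have M: "(2 * k) ^ 2 = 4 * k * k" "4 * (2 * k) div 2 = 4 * k"
    by (simp_all add: power2_eq_square)
  have q: "real (4 * k * k) / real (4 * k) = real k"
    using assms by simp
  have "omega (4 * (2 * k)) ((2 * k) ^ 2) = fact k powr (real (4 * k) / real k)"
    unfolding omega_def Let_def M q by simp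
  also have "real (4 * k) / real k = real 4"
    using assms by simp
  finally show ?thesis
    by (simp only: powr_realpow[of "fact k"] fact_gt_zero)
qed

text \<open>The list encodes the directed 4-cycle 0, 2, 1, 3 on block numbers; blocks 0 and 1 form
  the first colour class.\<close>

definition next_block :: "nat \<Rightarrow> nat" where
  "next_block b = [2, 3, 1, 0] ! b"

text \<open>The blow-up of the directed 4-cycle, each vertex replaced by \<open>k\<close> vertices;
  \<open>u div k\<close> is the block of \<open>u\<close>.\<close>

definition block_digraph :: "nat \<Rightarrow> nat pair_pre_digraph" where
  "block_digraph k = \<lparr> pverts = {0..<4 * k},
     parcs = {(u, v). u < 4 * k \<and> v < 4 * k \<and> v div k = next_block (u div k)} \<rparr>"

lemma less_4_cases: "b < 4 \<Longrightarrow> b = 0 \<or> b = 1 \<or> b = 2 \<or> b = (3 :: nat)"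
  by linarith

lemma next_block_less: "b < 4 \<Longrightarrow> next_block b < 4"
  using less_4_cases[of b] by (auto simp: next_block_def)

lemma next_block_inj: "inj_on next_block {..<4}"
  by (auto simp: inj_on_def next_block_def dest!: less_4_cases)

lemma next_block_crosses: "b < 4 \<Longrightarrow> b < 2 \<longleftrightarrow> \<not> next_block b < 2"
  using less_4_cases[of b] by (auto simp: next_block_def)

text \<open>The four pairs of a left and a right block are the edges of the 4-cycle, and the cycle
  traverses each in one direction only.\<close>

lemma next_block_oriented:
  "b < 2 \<Longrightarrow> c < 4 \<Longrightarrow> \<not> c < 2 \<Longrightarrow> c = next_block b \<longleftrightarrow> b \<noteq> next_block c"
  using less_4_cases[of b] less_4_cases[of c] by (auto simp: next_block_def)

lemma block_digraph_bip:
  assumes "k > 0"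
  shows "block_digraph k \<in> bip_digraphs (2 * k)"
proof -
  \<comment> \<open>This turns every range condition on vertices into one on block numbers, which
    leaves a finite check on four blocks.\<close>
  have less: "u < m * k \<longleftrightarrow> u div k < m" for u m
    using assms by (simp only: div_less_iff_less_mult)
  have Knn: "(u, v) \<in> parcs (Knn (2 * k)) \<longleftrightarrow>
      u div k < 4 \<and> v div k < 4 \<and> (u div k < 2 \<longleftrightarrow> \<not> v div k < 2)" for u v
    unfolding less[symmetric] by (auto simp: Knn_def)
  have D: "(u, v) \<in> parcs (block_digraph k) \<longleftrightarrow>
      u div k < 4 \<and> v div k < 4 \<and> v div k = next_block (u div k)" for u v
    unfolding less[symmetric] by (simp add: block_digraph_def)
  have "parcs (block_digraph k) \<subseteq> parcs (Knn (2 * k))"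
    using Knn D next_block_crosses by auto
  moreover have "(u, v) \<in> parcs (block_digraph k) \<longleftrightarrow> (v, u) \<notin> parcs (block_digraph k)"
    if "(u, v) \<in> parcs (Knn (2 * k))" for u v
    using that next_block_oriented[of "u div k" "v div k"] next_block_oriented[of "v div k" "u div k"]
    unfolding Knn D by blast
  moreover have "pverts (block_digraph k) = pverts (Knn (2 * k))"
    by (simp add: block_digraph_def Knn_def)
  ultimately show ?thesis
    unfolding bip_digraphs_def orientations_def by blast
qed

text \<open>The rows of block \<open>b\<close> are supported on all of block
  \<open>next_block b\<close>. Injectivity of \<open>next_block\<close> makes these column blocks
  disjoint, so the matrix contains four independent full \<open>k\<close> by \<open>k\<close>
  blocks.\<close>

lemma permanent_block_digraph_ge:
  assumes k: "k > 0"
  shows "fact k ^ 4 \<le> permanent (adjacency_matrix (block_digraph k))"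
proof -
  define A where "A i = {j. (i, j) \<in> parcs (block_digraph k)}" for i
  define block where "block b = {i. i div k = b}" for b
  have block_eq: "block b = {b * k..<b * k + k}" for b
  proof -
    have "i div k = b \<longleftrightarrow> b * k \<le> i \<and> i < Suc b * k" for i
      unfolding less_eq_div_iff_mult_less_eq[OF k, symmetric] div_less_iff_less_mult[OF k, symmetric]
      by linarith
    then show ?thesis
      by (simp add: block_def set_eq_iff add.commute)
  qed
  have less: "u < 4 * k \<longleftrightarrow> u div k < 4" for u
    using k by (simp only: div_less_iff_less_mult)
  have "fact k ^ card {..<4 :: nat} \<le> card (transversals (\<Union>b\<in>{..<4}. block b) A)"
  proof (rule fact_power_le_card_transversals[where J = "\<lambda>b. block (next_block b)"])
    show "A i = block (next_block b)" if "b \<in> {..<4}" "i \<in> block b" for b i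
      using that next_block_less[of b] by (auto simp: A_def block_digraph_def block_def less)
    show "disjoint_family_on block {..<4}"
      by (auto simp: disjoint_family_on_def block_def)
    show "disjoint_family_on (\<lambda>b. block (next_block b)) {..<4}"
      using next_block_inj by (auto simp: disjoint_family_on_def block_def inj_on_def)
  qed (simp_all add: block_eq)
  moreover have "(\<Union>b\<in>{..<4}. block b) = {0..<2 * (2 * k)}"
  proof -
    have "(\<Union>b\<in>{..<4}. block b) = {i. i div k < 4}"
      by (auto simp only: block_def lessThan_iff)
    also have "\<dots> = {0..<2 * (2 * k)}"
      unfolding less[symmetric] by auto
    finally show ?thesis .
  qed
  ultimately show ?thesis
    unfolding permanent_adjacency_matrix[OF block_digraph_bip[OF k]] A_def[abs_def] by simp
qed

theorem mainTheorem2: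
  fixes n :: nat
  assumes "n \<ge> 2"
  shows "(\<forall>D \<in> bip_digraphs n. real (permanent (adjacency_matrix D)) \<le> omega (4 * n) (n ^ 2)) \<and>
    (even n \<longrightarrow>
      (\<exists>D \<in> bip_digraphs n. real (permanent (adjacency_matrix D)) = omega (4 * n) (n ^ 2)))"
proof (intro conjI ballI impI)
  show "real (permanent (adjacency_matrix D)) \<le> omega (4 * n) (n ^ 2)" if "D \<in> bip_digraphs n" for D
    using permanent_le_omega[OF assms that] .
  assume "even n"
  then obtain k where k: "n = 2 * k" by blast
  have D: "block_digraph k \<in> bip_digraphs n"
    using block_digraph_bip[of k] k assms by simp
  have "omega (4 * n) (n ^ 2) = real (fact k ^ 4)"
    using omega_even[of k] assms k by simp
  also have "\<dots> \<le> real (permanent (adjacency_matrix (block_digraph k)))"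
    using k assms by (intro of_nat_mono permanent_block_digraph_ge) simp
  \<comment> \<open>The lower bound \<open>(k!)^4\<close> coincides with the upper bound, which
    forces equality.\<close>
  finally show "\<exists>D \<in> bip_digraphs n. real (permanent (adjacency_matrix D)) = omega (4 * n) (n ^ 2)"
    using permanent_le_omega[OF assms D] D by (intro bexI[of _ "block_digraph k"]) auto
qed

end
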